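(* Let $E$ be a finite set, let $S\subseteq 2^E$ be a powerful set, and let $e\in E$. Then the set $S/e:=\{X\subseteq E\setminus\{e\}\mid X\in S\}$, regarded as a family of subsets of the ground set $E\setminus\{e\}$, is a powerful set.
   Context: For a finite ground set $E$, a family $S\subseteq 2^E$ is called a powerful set if for every $X\subseteq E$ the number of members $Y\in S$ with $Y\cap X=\emptyset$ is a power of $2$ (i.e. equals $2^k$ for some integer $k\ge 0$). *)

theory Defs
  imports Main
begin

definition powerful_set :: "'a set \<Rightarrow> 'a set set \<Rightarrow> bool" where
  "powerful_set E S \<longleftrightarrow>
     finite E \<and> S \<subseteq> Pow E \<and>
     (\<forall>X. X \<subseteq> E \<longrightarrow> (\<exists>k::nat. card {Y \<in> S. Y \<inter> X = {}} = 2 ^ k))"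

definition contraction :: "'a set \<Rightarrow> 'a set set \<Rightarrow> 'a \<Rightarrow> 'a set set" where
  "contraction E S e = {X. X \<subseteq> E - {e} \<and> X \<in> S}"

end

theory Submission
  imports Defs
begin

text \<open>Contracting \<open>e\<close> amounts to adding \<open>e\<close> to the set that members
  must avoid: the count for \<open>X\<close> in the contraction is the count for
  \<open>insert e X\<close> in \<open>S\<close>, which is a power of 2 by hypothesis.\<close>

theorem theorem1:
  fixes E :: "'a set" and S :: "'a set set" and e :: 'a
  assumes "finite E" and "S \<subseteq> Pow E" and "powerful_set E S" and "e \<in> E"
  shows "powerful_set (E - {e}) (contraction E S e)"
proof -
  have "\<exists>k::nat. card {Y \<in> contraction E S e. Y \<inter> X = {}} = 2 ^ k"
    if "X \<subseteq> E - {e}" for X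
  proof -
    \<comment> \<open>From right to left, \<open>Y\<close> lies in \<open>E\<close> because
      \<open>S\<close> is a family of subsets of \<open>E\<close>, and missing \<open>e\<close> puts
      it inside \<open>E - {e}\<close>.\<close>
    have "{Y \<in> contraction E S e. Y \<inter> X = {}} = {Y \<in> S. Y \<inter> insert e X = {}}"
      using \<open>S \<subseteq> Pow E\<close> by (auto simp: contraction_def)
    moreover have "insert e X \<subseteq> E"
      using that \<open>e \<in> E\<close> by blast
    ultimately show ?thesis
      using \<open>powerful_set E S\<close> unfolding powerful_set_def by metis
  qed
  then show ?thesis
    using \<open>finite E\<close> by (auto simp: powerful_set_def contraction_def)
qed

end
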